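(* Let $(K,v)$ be a valued field, let $(K(X)|K,w)$ be a value transcendental extension of $(K,v)$, and let $E=\{z_\nu\}_{\nu<\lambda}$ be a Cauchy sequence of algebraic type in $(K,v)$. Assume that $X$ is a limit of $E$ (with respect to $w$). Then $w=v_E$.
   Context: Conventions. A valued field $(K,v)$ is a field with a (Krull) valuation, value group $vK$. Valuations with the same valuation ring are identified. $(K(X)|K,w)$ is value transcendental if $\dim_{\mathbb Q}\bigl(\mathbb Q\otimes_{\mathbb Z}(wK(X)/vK)\bigr)=1$. Let $\lambda$ be a limit ordinal. $E=\{z_\nu\}_{\nu<\lambda}\subseteq K$ is pseudo convergent (pcs) if $v(z_{\nu_1}-z_{\nu_2})<v(z_{\nu_2}-z_{\nu_3})$ for all $\nu_1<\nu_2<\nu_3<\lambda$; put $\delta_\nu:=v(z_\nu-z_{\nu+1})$. A pcs $E$ is a Cauchy sequence if $\{\delta_\nu\}_{\nu<\lambda}$ is cofinal in $vK$. A pcs $E$ is of algebraic type if there is $f\in K[X]$ such that $\{vf(z_\nu)\}_{\nu<\lambda}$ is not ultimately constant. An element $y$ of a valued extension field is a limit of $E$ if the value of $y-z_\nu$ is $\delta_\nu$ for all sufficiently large $\nu$. $v_E$ is the valuation of $K(X)$ with valuation ring $\{\phi\in K(X)\mid v\phi(z_\nu)\ge 0$ for all sufficiently large $\nu\}$ (maximal ideal given by $v\phi(z_\nu)>0$ for all sufficiently large $\nu$); it extends $v$. *)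

theory Defs
  imports
    "HOL-Computational_Algebra.Polynomial_Factorial"
    "HOL-Library.Extended"
    "HOL-Algebra.Free_Abelian_Groups"
    "Jordan_Normal_Form.Missing_VectorSpace"
begin

section \<open>Valued fields\<close>

text \<open>
  Valuations are written additively with \<^term>\<open>Pinf\<close> as the value of \<open>0\<close>; the element \<^term>\<open>Minf\<close>
  of \<^typ>\<open>'g extended\<close> is excluded. The type \<^typ>\<open>'g\<close> is an ambient ordered abelian group,
  and the value group is the subgroup of values actually attained.
\<close>

definition is_valuation :: "('k::field \<Rightarrow> 'g::linordered_ab_group_add extended) \<Rightarrow> bool" where
  "is_valuation v \<longleftrightarrow>
     (\<forall>x. v x \<noteq> Minf) \<and>
     (\<forall>x. v x = Pinf \<longleftrightarrow> x = 0) \<and>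
     (\<forall>x y. v (x * y) = v x + v y) \<and>
     (\<forall>x y. min (v x) (v y) \<le> v (x + y))"

definition value_group ::
  "('k::field \<Rightarrow> 'g::linordered_ab_group_add extended) \<Rightarrow> 'g monoid" where
  "value_group v = \<lparr>carrier = {g. \<exists>x. v x = Fin g}, mult = (+), one = 0\<rparr>"

definition valuation_ring ::
  "('k::field \<Rightarrow> 'g::linordered_ab_group_add extended) \<Rightarrow> 'k set" where
  "valuation_ring v = {x. 0 \<le> v x}"

text \<open>
  \<open>K(X)\<close> is \<^typ>\<open>'k poly fract\<close>. An extension \<open>w\<close> of \<open>v\<close> takes its values in the same ambient
  group, so that \<open>vK\<close> is a subgroup of \<open>wK(X)\<close>.
\<close>

definition const_fract :: "'k::field \<Rightarrow> 'k poly fract" where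
  "const_fract a = to_fract [:a:]"

definition X_fract :: "'k::field poly fract" where
  "X_fract = to_fract [:0, 1:]"

definition extends_valuation ::
  "('k::field poly fract \<Rightarrow> 'g::linordered_ab_group_add extended) \<Rightarrow> ('k \<Rightarrow> 'g extended) \<Rightarrow> bool" where
  "extends_valuation w v \<longleftrightarrow> (\<forall>a. w (const_fract a) = v a)"

section \<open>The rational vector space \<open>\<rat> \<otimes> A\<close>\<close>

definition rat_field :: "rat ring" where
  "rat_field = \<lparr>carrier = UNIV, mult = (*), one = 1, zero = 0, add = (+)\<rparr>"

definition tensor_relations :: "('a, 'm) monoid_scheme \<Rightarrow> ((rat \<times> 'a) \<Rightarrow>\<^sub>0 int) set" where
  "tensor_relations A =
     {frag_of (q + r, a) - frag_of (q, a) - frag_of (r, a) | q r a. a \<in> carrier A} \<union>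
     {frag_of (q, a \<otimes>\<^bsub>A\<^esub> b) - frag_of (q, a) - frag_of (q, b) | q a b.
        a \<in> carrier A \<and> b \<in> carrier A}"

definition tensor_kernel :: "('a, 'm) monoid_scheme \<Rightarrow> ((rat \<times> 'a) \<Rightarrow>\<^sub>0 int) set" where
  "tensor_kernel A = generate (free_Abelian_group (UNIV \<times> carrier A)) (tensor_relations A)"

definition tensor_scale :: "rat \<Rightarrow> ((rat \<times> 'a) \<Rightarrow>\<^sub>0 int) \<Rightarrow> ((rat \<times> 'a) \<Rightarrow>\<^sub>0 int)" where
  "tensor_scale q = frag_extend (\<lambda>(r, a). frag_of (q * r, a))"

text \<open>
  The tensor product over the integers of the additive group of \<open>\<rat>\<close> with an abelian group \<open>A\<close>:
  the free abelian group on \<open>\<rat> \<times> A\<close> modulo the bilinearity relations, with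
  \<open>q (r \<otimes> a) = (q r) \<otimes> a\<close>. Elements are cosets of \<^const>\<open>tensor_kernel\<close>. The ring multiplication
  that a \<open>module\<close> record also carries plays no role.
\<close>

definition rat_tensor ::
  "('a, 'm) monoid_scheme \<Rightarrow> (rat, ((rat \<times> 'a) \<Rightarrow>\<^sub>0 int) set) module" where
  "rat_tensor A =
     (let F = free_Abelian_group (UNIV \<times> carrier A); R = tensor_kernel A; T = F Mod R in
      \<lparr>carrier = carrier T, mult = undefined, one = undefined,
       zero = one T, add = mult T,
       smult = (\<lambda>q C. R <#>\<^bsub>F\<^esub> (tensor_scale q ` C))\<rparr>)"

lemma field_rat_field: "field rat_field"
proof -
  have "cring rat_field"
  proof (rule cringI)
    show "abelian_group rat_field"
      by (rule abelian_groupI)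
        (auto simp: rat_field_def intro: exI[of _ "- x" for x] left_minus)
    show "comm_monoid rat_field"
      by unfold_locales (auto simp: rat_field_def)
  qed (auto simp: rat_field_def algebra_simps)
  then show ?thesis
  proof (rule cring.cring_fieldI2)
    fix a assume "a \<in> carrier rat_field" "a \<noteq> \<zero>\<^bsub>rat_field\<^esub>"
    then show "\<exists>b\<in>carrier rat_field. a \<otimes>\<^bsub>rat_field\<^esub> b = \<one>\<^bsub>rat_field\<^esub>"
      by (auto simp: rat_field_def intro!: exI[of _ "inverse a"])
  qed (simp add: rat_field_def)
qed

lemma vectorspace_rat_tensor:
  assumes "comm_group A"
  shows "vectorspace rat_field (rat_tensor A)"
proof -
  interpret A: comm_group A by fact
  define S :: "(rat \<times> 'a) set" where "S = UNIV \<times> carrier A"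
  define F where "F = free_Abelian_group S"
  define R where "R = tensor_kernel A"
  interpret F: comm_group F
    unfolding F_def by (rule abelian_free_Abelian_group)
  have Fc: "x \<in> carrier F \<longleftrightarrow> Poly_Mapping.keys x \<subseteq> S" for x by (simp add: F_def)
  have Fm: "x \<otimes>\<^bsub>F\<^esub> y = x + y" for x y by (simp add: F_def)
  have Fd: "x - y \<in> carrier F" if "x \<in> carrier F" "y \<in> carrier F" for x y
    using that keys_diff[of x y] by (auto simp: Fc)
  have Fof: "frag_of (q, a) \<in> carrier F" if "a \<in> carrier A" for q a
    using that by (simp add: Fc S_def)
  have rels: "tensor_relations A \<subseteq> carrier F"
    by (auto simp: tensor_relations_def intro!: Fd Fof)
  have Rgen: "R = generate F (tensor_relations A)"
    by (simp add: R_def tensor_kernel_def F_def S_def)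
  have Rsub: "subgroup R F"
    unfolding Rgen by (rule F.generate_is_subgroup[OF rels])
  then have Rn: "R \<lhd> F" by (rule F.subgroup_imp_normal)
  interpret R: normal R F by fact
  have Rc: "x \<in> carrier F" if "x \<in> R" for x using that R.subset by auto
  have Rinv: "- x \<in> R" if "x \<in> R" for x
    using R.m_inv_closed[OF that] Rc[OF that] by (simp add: F_def Fc)
  have Radd: "x + y \<in> R" if "x \<in> R" "y \<in> R" for x y
    using R.m_closed[OF that] by (simp add: Fm)
  have R0: "0 \<in> R" using R.one_closed by (simp add: F_def)
  let ?s = tensor_scale
  have s_add: "?s q (x + y) = ?s q x + ?s q y" for q and x y :: "(rat \<times> 'a) \<Rightarrow>\<^sub>0 int"
    by (simp add: tensor_scale_def frag_extend_add)
  have s_diff: "?s q (x - y) = ?s q x - ?s q y" for q and x y :: "(rat \<times> 'a) \<Rightarrow>\<^sub>0 int"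
    by (simp add: tensor_scale_def frag_extend_diff)
  have s_min: "?s q (- x) = - ?s q x" for q and x :: "(rat \<times> 'a) \<Rightarrow>\<^sub>0 int"
    by (simp add: tensor_scale_def frag_extend_minus)
  have s_of: "?s q (frag_of (r, a)) = frag_of (q * r, a)" for q r and a :: 'a
    by (simp add: tensor_scale_def)
  have s_0: "?s q 0 = (0 :: (rat \<times> 'a) \<Rightarrow>\<^sub>0 int)" for q by (simp add: tensor_scale_def)
  have s_c: "?s q x \<in> carrier F" if "x \<in> carrier F" for q x
  proof -
    have "Poly_Mapping.keys (?s q x) \<subseteq>
        (\<Union>y\<in>Poly_Mapping.keys x. Poly_Mapping.keys (case y of (r, a) \<Rightarrow> frag_of (q * r, a)))"
      unfolding tensor_scale_def by (rule keys_frag_extend)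
    also have "\<dots> \<subseteq> S"
      using that by (auto simp: Fc S_def)
    finally show ?thesis by (simp add: Fc)
  qed
  have s_rel: "?s q x \<in> R" if "x \<in> tensor_relations A" for q x
  proof -
    have "?s q x \<in> tensor_relations A"
      using that unfolding tensor_relations_def
      by (fastforce simp: s_diff s_of distrib_left)
    then show ?thesis unfolding Rgen by (rule generate.incl)
  qed
  have s_R: "?s q x \<in> R" if "x \<in> R" for q x
  proof -
    have "x \<in> generate F (tensor_relations A)" using that by (simp add: Rgen)
    then show ?thesis
    proof (induction rule: generate.induct)
      case one
      then show ?case using R0 by (simp add: F_def s_0)
    next
      case (incl h)
      then show ?case by (rule s_rel)
    next
      case (inv h)
      then have "inv\<^bsub>F\<^esub> h = - h" using rels by (auto simp: F_def Fc)
      then show ?case using Rinv[OF s_rel[OF inv]] by (simp add: s_min)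
    next
      case (eng h1 h2)
      then show ?case using Radd by (simp add: Fm s_add)
    qed
  qed
  let ?c = "\<lambda>x. R #>\<^bsub>F\<^esub> x"
  have mem: "y \<in> ?c x \<longleftrightarrow> y - x \<in> R" for x y
    by (auto simp: r_coset_def Fm) (metis diff_add_cancel)
  have ceq: "?c x = ?c y \<longleftrightarrow> x - y \<in> R" for x y
  proof
    assume "?c x = ?c y"
    moreover have "x \<in> ?c x" using R0 by (simp add: mem)
    ultimately show "x - y \<in> R" by (simp add: mem)
  next
    assume *: "x - y \<in> R"
    show "?c x = ?c y"
    proof (rule Set.set_eqI)
      fix z
      show "z \<in> ?c x \<longleftrightarrow> z \<in> ?c y"
        unfolding mem using Radd[of "z - x" "x - y"] Radd[of "z - y" "- (x - y)"] Rinv[OF *] *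
        by auto
    qed
  qed
  let ?V = "rat_tensor A"
  have Vc: "carrier ?V = ?c ` carrier F"
    by (auto simp: rat_tensor_def Let_def FactGroup_def RCOSETS_def R_def F_def S_def)
  have Vz: "\<zero>\<^bsub>?V\<^esub> = ?c 0"
    using F.coset_mult_one[OF R.subset]
    by (simp add: rat_tensor_def Let_def FactGroup_def R_def F_def S_def)
  have Va: "?c x \<oplus>\<^bsub>?V\<^esub> ?c y = ?c (x + y)" if "x \<in> carrier F" "y \<in> carrier F" for x y
    using R.rcos_sum[OF that]
    by (simp add: rat_tensor_def Let_def FactGroup_def R_def F_def S_def)
  have Vs: "q \<odot>\<^bsub>?V\<^esub> ?c x = ?c (?s q x)" if x: "x \<in> carrier F" for q x
  proof -
    have "q \<odot>\<^bsub>?V\<^esub> ?c x = R <#>\<^bsub>F\<^esub> (?s q ` ?c x)"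
      by (simp add: rat_tensor_def Let_def R_def F_def S_def)
    also have "\<dots> = ?c (?s q x)"
    proof (intro equalityI subsetI)
      fix z assume "z \<in> R <#>\<^bsub>F\<^esub> (?s q ` ?c x)"
      then obtain r y where ry: "r \<in> R" "y - x \<in> R" "z = r + ?s q y"
        by (auto simp: set_mult_def Fm mem)
      have "z - ?s q x = r + ?s q (y - x)" by (simp add: ry s_diff)
      then show "z \<in> ?c (?s q x)" using Radd[OF ry(1) s_R[OF ry(2)]] by (simp add: mem)
    next
      fix z assume "z \<in> ?c (?s q x)"
      moreover have "x \<in> ?c x" using R0 by (simp add: mem)
      ultimately show "z \<in> R <#>\<^bsub>F\<^esub> (?s q ` ?c x)"
        by (auto simp only: set_mult_def r_coset_def)
    qed
    finally show ?thesis .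
  qed
  have s_1: "?s 1 x = x" for x :: "(rat \<times> 'a) \<Rightarrow>\<^sub>0 int"
    using frag_expansion[of x] by (simp add: tensor_scale_def case_prod_unfold)
  have s_s: "?s p (?s q x) = ?s (p * q) x" if "x \<in> carrier F" for p q x
  proof -
    have "Poly_Mapping.keys x \<subseteq> S" using that by (simp add: Fc)
    then show ?thesis
      by (induction x rule: frag_induction) (auto simp: s_0 s_of s_diff mult.assoc)
  qed
  have s_dist: "?s (p + q) x - (?s p x + ?s q x) \<in> R" if "x \<in> carrier F" for p q x
  proof -
    have "Poly_Mapping.keys x \<subseteq> S" using that by (simp add: Fc)
    then show ?thesis
    proof (induction x rule: frag_induction)
      case zero
      then show ?case using R0 by (simp add: s_0)
    next
      case (one y)
      obtain r a where y: "y = (r, a)" "a \<in> carrier A" using one by (auto simp: S_def)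
      have "frag_of (p * r + q * r, a) - frag_of (p * r, a) - frag_of (q * r, a)
              \<in> tensor_relations A"
        using y by (auto simp: tensor_relations_def)
      then have "frag_of (p * r + q * r, a) - frag_of (p * r, a) - frag_of (q * r, a) \<in> R"
        unfolding Rgen by (rule generate.incl)
      then show ?case by (simp add: y s_of distrib_right diff_diff_eq)
    next
      case (diff a b)
      then show ?case
        using Radd[OF diff(1) Rinv[OF diff(2)]] by (simp add: s_diff algebra_simps)
    qed
  qed
  have s_dist': "?c (?s (p + q) x) = ?c (?s p x + ?s q x)" if "x \<in> carrier F" for p q x
    using s_dist[OF that] by (simp only: ceq)
  have Fp: "x + y \<in> carrier F" if "x \<in> carrier F" "y \<in> carrier F" for x y
    using F.m_closed[OF that] by (simp add: Fm)
  have F0: "0 \<in> carrier F" by (simp add: Fc)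
  have "module rat_field ?V"
  proof (rule module_criteria)
    show "cring rat_field" using field_rat_field by (simp add: field_def domain_def)
    show "\<zero>\<^bsub>?V\<^esub> \<in> carrier ?V" using F0 by (simp add: Vc Vz)
    show "\<forall>v\<in>carrier ?V. \<exists>u\<in>carrier ?V. v \<oplus>\<^bsub>?V\<^esub> u = \<zero>\<^bsub>?V\<^esub>"
    proof
      fix v assume "v \<in> carrier ?V"
      then obtain x where x: "x \<in> carrier F" "v = ?c x" by (auto simp: Vc)
      have "- x \<in> carrier F" using Fd[OF F0 x(1)] by simp
      then show "\<exists>u\<in>carrier ?V. v \<oplus>\<^bsub>?V\<^esub> u = \<zero>\<^bsub>?V\<^esub>"
        using x by (intro bexI[of _ "?c (- x)"]) (auto simp: Va Vz Vc)
    qed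
    show "\<forall>a b v. a \<in> carrier rat_field \<and> b \<in> carrier rat_field \<and> v \<in> carrier ?V \<longrightarrow>
        (a \<oplus>\<^bsub>rat_field\<^esub> b) \<odot>\<^bsub>?V\<^esub> v = (a \<odot>\<^bsub>?V\<^esub> v) \<oplus>\<^bsub>?V\<^esub> (b \<odot>\<^bsub>?V\<^esub> v)"
      by (auto simp: Vc Vs Va s_c s_dist' rat_field_def)
  qed (auto simp: Vc Vs Va Vz Fp F0 s_c s_1 s_s s_add rat_field_def ac_simps)
  then show ?thesis by (simp add: vectorspace_def field_rat_field)
qed

definition value_transcendental ::
  "('k::field \<Rightarrow> 'g::linordered_ab_group_add extended) \<Rightarrow>
   ('k poly fract \<Rightarrow> 'g extended) \<Rightarrow> bool" where
  "value_transcendental v w \<longleftrightarrow>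
     (let Q = rat_tensor (value_group w Mod carrier (value_group v)) in
      vectorspace.fin_dim rat_field Q \<and> vectorspace.dim rat_field Q = 1)"

section \<open>Pseudo convergent sequences\<close>

text \<open>
  A limit ordinal \<open>\<lambda>\<close> is represented as a well-ordered index type \<^typ>\<open>'i\<close> without largest element;
  \<^term>\<open>at_top\<close> then expresses \<^emph>\<open>for all sufficiently large \<open>\<nu> < \<lambda>\<close>\<close>.
\<close>

definition pcs ::
  "('k::field \<Rightarrow> 'g::linordered_ab_group_add extended) \<Rightarrow>
   ('i::{wellorder,no_top} \<Rightarrow> 'k) \<Rightarrow> bool" where
  "pcs v z \<longleftrightarrow>
     (\<forall>\<nu>1 \<nu>2 \<nu>3. \<nu>1 < \<nu>2 \<and> \<nu>2 < \<nu>3 \<longrightarrow> v (z \<nu>1 - z \<nu>2) < v (z \<nu>2 - z \<nu>3))"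

definition ord_succ :: "'i::{wellorder,no_top} \<Rightarrow> 'i" where
  "ord_succ \<nu> = (LEAST \<mu>. \<nu> < \<mu>)"

definition pcs_delta ::
  "('k::field \<Rightarrow> 'g::linordered_ab_group_add extended) \<Rightarrow>
   ('i::{wellorder,no_top} \<Rightarrow> 'k) \<Rightarrow> 'i \<Rightarrow> 'g extended" where
  "pcs_delta v z \<nu> = v (z \<nu> - z (ord_succ \<nu>))"

definition cauchy_pcs ::
  "('k::field \<Rightarrow> 'g::linordered_ab_group_add extended) \<Rightarrow>
   ('i::{wellorder,no_top} \<Rightarrow> 'k) \<Rightarrow> bool" where
  "cauchy_pcs v z \<longleftrightarrow>
     pcs v z \<and> (\<forall>\<gamma>\<in>carrier (value_group v). \<exists>\<nu>. Fin \<gamma> \<le> pcs_delta v z \<nu>)"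

definition algebraic_type ::
  "('k::field \<Rightarrow> 'g::linordered_ab_group_add extended) \<Rightarrow>
   ('i::{wellorder,no_top} \<Rightarrow> 'k) \<Rightarrow> bool" where
  "algebraic_type v z \<longleftrightarrow>
     (\<exists>f::'k poly. \<not> (\<exists>c. \<forall>\<^sub>F \<nu> in at_top. v (poly f (z \<nu>)) = c))"

definition pcs_limit ::
  "('k::field \<Rightarrow> 'g::linordered_ab_group_add extended) \<Rightarrow>
   ('k poly fract \<Rightarrow> 'g extended) \<Rightarrow> ('i::{wellorder,no_top} \<Rightarrow> 'k) \<Rightarrow> 'k poly fract \<Rightarrow> bool" where
  "pcs_limit v w z y \<longleftrightarrow> (\<forall>\<^sub>F \<nu> in at_top. w (y - const_fract (z \<nu>)) = pcs_delta v z \<nu>)"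

section \<open>The valuation \<open>v\<^sub>E\<close>\<close>

text \<open>\<open>fract_value \<phi> a b\<close>: the rational function \<open>\<phi>\<close> has no pole at \<open>a\<close>, and \<open>\<phi>(a) = b\<close>.\<close>

definition fract_value :: "'k::field poly fract \<Rightarrow> 'k \<Rightarrow> 'k \<Rightarrow> bool" where
  "fract_value \<phi> a b \<longleftrightarrow>
     (\<exists>p q. \<phi> = Fract p q \<and> poly q a \<noteq> 0 \<and> b = poly p a / poly q a)"

lemma fract_value_unique:
  assumes "fract_value \<phi> a b" and "fract_value \<phi> a c"
  shows "b = c"
proof -
  obtain p q where pq: "\<phi> = Fract p q" "poly q a \<noteq> 0" "b = poly p a / poly q a"
    using assms(1) unfolding fract_value_def by blast
  obtain r s where rs: "\<phi> = Fract r s" "poly s a \<noteq> 0" "c = poly r a / poly s a"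
    using assms(2) unfolding fract_value_def by blast
  have "q \<noteq> 0" "s \<noteq> 0" using pq(2) rs(2) by auto
  then have "p * s = r * q" using pq(1) rs(1) by (metis eq_fract(1))
  then have "poly p a * poly s a = poly r a * poly q a" by (metis poly_mult)
  then show ?thesis using pq rs by (simp add: frac_eq_eq)
qed

text \<open>
  The valuation ring of \<open>v\<^sub>E\<close>. Valuations with the same valuation ring are identified, so this set
  determines \<open>v\<^sub>E\<close>, and \<open>w = v\<^sub>E\<close> means that it is the valuation ring of \<open>w\<close>.
\<close>

definition vE_ring ::
  "('k::field \<Rightarrow> 'g::linordered_ab_group_add extended) \<Rightarrow>
   ('i::{wellorder,no_top} \<Rightarrow> 'k) \<Rightarrow> 'k poly fract set" where
  "vE_ring v z = {\<phi>. \<forall>\<^sub>F \<nu> in at_top. \<exists>b. fract_value \<phi> (z \<nu>) b \<and> 0 \<le> v b}"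

end

theory Submission
  imports Defs
begin

text \<open>
  Since \<open>E\<close> is Cauchy with limit \<open>X\<close>, the values of \<open>f(X) - f(z\<^sub>\<nu>)\<close> eventually exceed every element
  of \<open>vK\<close>, for each polynomial \<open>f\<close>. So either \<open>w(f)\<close> is bounded by an element of \<open>vK\<close>, and then
  \<open>v f(z\<^sub>\<nu>) = w(f)\<close> eventually, or \<open>w(f) > vK\<close>, and then \<open>v f(z\<^sub>\<nu>)\<close> eventually exceeds every element
  of \<open>vK\<close>. By the Bezout identity two coprime polynomials \<open>p, q\<close> are not both of the second kind,
  so that \<open>w(q) \<le> w(p)\<close> is equivalent to \<open>v q(z\<^sub>\<nu>) \<le> v p(z\<^sub>\<nu>)\<close> for all large \<open>\<nu>\<close>.
\<close>

section \<open>Valuations\<close>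

context
  fixes u :: "'k::field \<Rightarrow> 'g::linordered_ab_group_add extended"
  assumes u: "is_valuation u"
begin

lemma valuation_mult: "u (x * y) = u x + u y"
  using u by (auto simp: is_valuation_def)

lemma valuation_add: "min (u x) (u y) \<le> u (x + y)"
  using u by (auto simp: is_valuation_def)

lemma valuation_eq_Pinf_iff: "u x = Pinf \<longleftrightarrow> x = 0"
  using u by (auto simp: is_valuation_def)

lemma valuation_cases:
  obtains "x = 0" "u x = Pinf" | g where "x \<noteq> 0" "u x = Fin g"
  using u by (cases "u x") (auto simp: is_valuation_def)

lemma valuation_one: "u 1 = 0"
proof (cases rule: valuation_cases[of 1])
  case (2 g)
  then have "Fin g = Fin (g + g)"
    using valuation_mult[of 1 1] by simp
  then show ?thesis
    using 2 by (simp add: zero_extended_def)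
qed simp

lemma valuation_minus: "u (- x) = u x"
proof -
  have "u (- 1) = 0"
  proof (cases rule: valuation_cases[of "- 1"])
    case (2 g)
    \<comment> \<open>A linearly ordered group has no element of order two, so
      \<open>g = 0\<close>.\<close>
    then have "g + g = 0"
      using valuation_mult[of "- 1" "- 1"] by (simp add: valuation_one zero_extended_def)
    then show ?thesis
      using 2 by (simp add: double_zero zero_extended_def)
  qed simp
  then show ?thesis
    using valuation_mult[of "- 1" x] by simp
qed

lemma valuation_diff: "min (u x) (u y) \<le> u (x - y)"
  using valuation_add[of x "- y"] by (simp add: valuation_minus)

lemma valuation_eq_of_close:
  assumes "u x < u (x - y)"
  shows "u y = u x"
proof (rule antisym)
  have "min (u y) (u (x - y)) \<le> u x"
    using valuation_add[of y "x - y"] by simp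
  then show "u y \<le> u x"
    using assms by (auto simp: min_le_iff_disj)
  have "min (u x) (u (x - y)) \<le> u y"
    using valuation_diff[of x "x - y"] by simp
  then show "u x \<le> u y"
    using assms by (auto simp: min_def split: if_splits)
qed

lemma valuation_divide_nonneg_iff:
  assumes "y \<noteq> 0"
  shows "0 \<le> u (x / y) \<longleftrightarrow> u y \<le> u x"
proof -
  have "u x = u (x / y) + u y"
    using valuation_mult[of "x / y" y] assms by simp
  then show ?thesis
    using assms
    by (cases rule: valuation_cases[of "x / y"]; cases rule: valuation_cases[of y])
      (auto simp: zero_extended_def)
qed

end

section \<open>Coprime representations of rational functions\<close>

text \<open>Euclid's algorithm, by induction on the size of the second polynomial. Asking only for a
  common divisor with Bezout coefficients avoids choosing a normalised gcd.\<close>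

lemma bezout_poly:
  fixes p q :: "'k::field poly"
  obtains d r s where "d = r * p + s * q" "d dvd p" "d dvd q"
proof -
  have "\<exists>d r s. d = r * p + s * q \<and> d dvd p \<and> d dvd q"
  proof (induction "euclidean_size q" arbitrary: p q rule: less_induct)
    case less
    show ?case
    proof (cases "q = 0")
      case True
      then show ?thesis
        by (intro exI[of _ p] exI[of _ 1]) auto
    next
      case False
      then obtain d r s where "d = r * q + s * (p mod q)" and d: "d dvd q" "d dvd p mod q"
        using less[OF mod_size_less[OF False], of q p] by blast
      then have "d = r * q + s * (p - p div q * q)"
        by (simp only: minus_div_mult_eq_mod)
      then have "d = s * p + (r - s * (p div q)) * q"
        by (simp add: algebra_simps)
      moreover have "d dvd p"
        using d by (simp add: dvd_mod_iff)
      ultimately show ?thesis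
        using d by blast
    qed
  qed
  then show thesis
    using that by blast
qed

text \<open>Dividing numerator, denominator and the Bezout identity by the common divisor
  \<open>d\<close> leaves coefficients that witness coprimality.\<close>

lemma coprime_Fract_representation:
  fixes \<phi> :: "'k::field poly fract"
  obtains p q r s where "\<phi> = Fract p q" "q \<noteq> 0" "r * p + s * q = 1"
proof -
  obtain p q where \<phi>: "\<phi> = Fract p q" "q \<noteq> 0"
    by (cases \<phi>)
  obtain d r s where d: "d = r * p + s * q" "d dvd p" "d dvd q"
    by (rule bezout_poly)
  then obtain p' q' where pq: "p = d * p'" "q = d * q'"
    by (meson dvdE)
  then have "d \<noteq> 0" "q' \<noteq> 0"
    using \<phi> by auto
  moreover have "d * (r * p' + s * q') = d * 1"
    using d(1) pq by (simp add: algebra_simps)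
  ultimately have "r * p' + s * q' = 1"
    by (metis mult_cancel_left)
  moreover have "\<phi> = Fract p' q'"
    using \<phi> pq \<open>d \<noteq> 0\<close> \<open>q' \<noteq> 0\<close> by (simp add: eq_fract)
  ultimately show thesis
    using that \<open>q' \<noteq> 0\<close> by blast
qed

text \<open>\<open>fract_value\<close> admits any representation. If some denominator
  \<open>q'\<close> is nonzero at \<open>a\<close> while \<open>q\<close> vanishes there,
  cross-multiplication makes \<open>p\<close> vanish too, against the Bezout identity.\<close>

lemma fract_value_coprime_iff:
  assumes "r * p + s * q = 1" "q \<noteq> 0"
  shows "fract_value (Fract p q) a b \<longleftrightarrow> poly q a \<noteq> 0 \<and> b = poly p a / poly q a"
proof
  assume b: "fract_value (Fract p q) a b"
  then obtain p' q' where pq': "Fract p q = Fract p' q'" "poly q' a \<noteq> 0"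
    by (auto simp: fract_value_def)
  then have "q' \<noteq> 0"
    by auto
  then have "p * q' = p' * q"
    using pq' assms by (simp add: eq_fract)
  then have eq: "poly p a * poly q' a = poly p' a * poly q a"
    by (metis poly_mult)
  have "poly r a * poly p a + poly s a * poly q a = 1"
    using arg_cong[OF assms(1), of "\<lambda>f. poly f a"] by simp
  then have "poly q a \<noteq> 0"
    using eq pq'(2) by auto
  moreover from this have "fract_value (Fract p q) a (poly p a / poly q a)"
    by (auto simp: fract_value_def)
  ultimately show "poly q a \<noteq> 0 \<and> b = poly p a / poly q a"
    using b fract_value_unique by blast
qed (auto simp: fract_value_def)

text \<open>Poles need no separate clause: if \<open>q\<close> vanishes at \<open>a\<close>, then
  \<open>p\<close> does not, and \<open>Pinf \<le> v (poly p a)\<close> fails, just as no value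
  exists on the left.\<close>

lemma fract_value_nonneg_iff:
  assumes "is_valuation v" "r * p + s * q = 1" "q \<noteq> 0"
  shows "(\<exists>b. fract_value (Fract p q) a b \<and> 0 \<le> v b) \<longleftrightarrow> v (poly q a) \<le> v (poly p a)"
proof (cases "poly q a = 0")
  case True
  then have "poly r a * poly p a = 1"
    using arg_cong[OF assms(2), of "\<lambda>f. poly f a"] by simp
  then have "poly p a \<noteq> 0"
    by auto
  then show ?thesis
    using True assms
    by (simp add: fract_value_coprime_iff valuation_eq_Pinf_iff valuation_eq_Pinf_iff[THEN iffD2])
next
  case False
  then show ?thesis
    using assms by (simp add: fract_value_coprime_iff valuation_divide_nonneg_iff)
qed

section \<open>Limits of Cauchy sequences\<close>

locale cauchy_limit =
  fixes v :: "'k::field \<Rightarrow> 'g::linordered_ab_group_add extended"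
    and w :: "'k poly fract \<Rightarrow> 'g extended"
    and z :: "'i::{wellorder,no_top} \<Rightarrow> 'k"
  assumes v: "is_valuation v"
    and w: "is_valuation w"
    and extends: "extends_valuation w v"
    and cauchy: "cauchy_pcs v z"
    and limit: "pcs_limit v w z X_fract"
begin

section \<open>Approximation of \<open>X\<close> by the terms of the sequence\<close>

lemma w_const: "w (const_fract a) = v a"
  using extends by (simp add: extends_valuation_def)

lemma less_ord_succ: "\<nu> < ord_succ \<nu>" for \<nu> :: 'i
  unfolding ord_succ_def using gt_ex by (rule LeastI_ex)

lemma pcs_delta_strict_mono:
  assumes "\<nu> < \<mu>"
  shows "pcs_delta v z \<nu> < pcs_delta v z \<mu>"
proof -
  have pcs: "v (z \<nu>1 - z \<nu>2) < v (z \<nu>2 - z \<nu>3)" if "\<nu>1 < \<nu>2" "\<nu>2 < \<nu>3" for \<nu>1 \<nu>2 \<nu>3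
    using cauchy that by (auto simp: cauchy_pcs_def pcs_def)
  have "ord_succ \<nu> \<le> \<mu>"
    unfolding ord_succ_def using assms by (rule Least_le)
  then consider "ord_succ \<nu> = \<mu>" | "ord_succ \<nu> < \<mu>"
    by force
  then show ?thesis
  proof cases
    case 1
    then show ?thesis
      using pcs[OF assms less_ord_succ] by (simp add: pcs_delta_def)
  next
    \<comment> \<open>The pcs condition compares only differences that share a term, so
      \<open>z (ord_succ \<nu>) - z \<mu>\<close> serves as the link.\<close>
    case 2
    then show ?thesis
      using pcs[OF less_ord_succ 2] pcs[OF 2 less_ord_succ]
      by (simp add: pcs_delta_def)
  qed
qed

lemma eventually_X_close:
  assumes "a \<noteq> 0"
  shows "\<forall>\<^sub>F \<nu> in at_top. v a < w (X_fract - const_fract (z \<nu>))"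
proof -
  obtain g where g: "v a = Fin g"
    using assms by (cases rule: valuation_cases[OF v, of a]) auto
  then obtain \<nu>0 where "v a \<le> pcs_delta v z \<nu>0"
    using cauchy by (auto simp: cauchy_pcs_def value_group_def)
  \<comment> \<open>The Cauchy condition gives \<open>\<le>\<close> at one index; strict growth
    turns it into \<open><\<close> at all later ones.\<close>
  then have "v a < pcs_delta v z \<nu>" if "\<nu>0 < \<nu>" for \<nu>
    using pcs_delta_strict_mono[OF that] by simp
  then have "\<forall>\<^sub>F \<nu> in at_top. v a < pcs_delta v z \<nu>"
    using eventually_gt_at_top[of \<nu>0] by (rule eventually_mono[rotated])
  moreover have "\<forall>\<^sub>F \<nu> in at_top. w (X_fract - const_fract (z \<nu>)) = pcs_delta v z \<nu>"
    using limit by (simp add: pcs_limit_def)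
  ultimately show ?thesis
    by eventually_elim simp
qed

section \<open>The ring of elements bounded below by \<open>vK\<close>\<close>

text \<open>
  Elements of \<open>vK\<close> are written \<open>v a\<close> with \<open>a \<noteq> 0\<close>.
\<close>

definition bounded :: "'k poly fract \<Rightarrow> bool" where
  "bounded \<phi> \<longleftrightarrow> (\<exists>a. a \<noteq> 0 \<and> v a \<le> w \<phi>)"

lemma bounded_add:
  assumes "bounded \<phi>" "bounded \<psi>"
  shows "bounded (\<phi> + \<psi>)"
proof -
  obtain a b where "a \<noteq> 0" "b \<noteq> 0" "v a \<le> w \<phi>" "v b \<le> w \<psi>"
    using assms by (auto simp: bounded_def)
  then show ?thesis
    using valuation_add[OF w, of \<phi> \<psi>] unfolding bounded_def
    by (meson min_le_iff_disj order_trans)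
qed

lemma bounded_mult:
  assumes "bounded \<phi>" "bounded \<psi>"
  shows "bounded (\<phi> * \<psi>)"
proof -
  obtain a b where "a \<noteq> 0" "b \<noteq> 0" "v a \<le> w \<phi>" "v b \<le> w \<psi>"
    using assms by (auto simp: bounded_def)
  then show ?thesis
    unfolding bounded_def valuation_mult[OF w]
    by (intro exI[of _ "a * b"]) (simp add: valuation_mult[OF v] add_mono)
qed

lemma bounded_const: "bounded (const_fract a)"
  unfolding bounded_def w_const
  by (cases "a = 0") (auto simp: valuation_eq_Pinf_iff[OF v, THEN iffD2] intro: exI[of _ 1])

lemma bounded_X: "bounded X_fract"
proof -
  \<comment> \<open>One term close to \<open>X\<close> suffices: \<open>X\<close> is that constant
    plus a difference of value above \<open>v 1\<close>.\<close>
  obtain \<nu> where "v 1 < w (X_fract - const_fract (z \<nu>))"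
    using eventually_happens[OF eventually_X_close[of 1]] by auto
  then have "bounded (X_fract - const_fract (z \<nu>))"
    unfolding bounded_def by (intro exI[of _ 1]) auto
  from bounded_add[OF this bounded_const] show ?thesis
    by (metis diff_add_cancel)
qed

lemma to_fract_pCons: "to_fract (pCons a p) = const_fract a + X_fract * to_fract p"
  for p :: "'k poly"
  by (simp add: const_fract_def X_fract_def flip: to_fract_mult to_fract_add)

lemma bounded_poly: "bounded (to_fract p)"
proof (induction p)
  case 0
  then show ?case
    using bounded_const[of 0] by (simp add: const_fract_def)
next
  case (pCons a p)
  then show ?case
    by (simp add: to_fract_pCons bounded_add bounded_mult bounded_const bounded_X)
qed

section \<open>Values of polynomials along the sequence\<close>

text \<open>A factor that may lower the value, but by no more than an element of \<open>vK\<close>,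
  is compensated by asking for \<open>v (a / b)\<close> in place of \<open>v a\<close>.\<close>

lemma less_w_mult:
  assumes "b \<noteq> 0" "v b \<le> w \<phi>" "v (a / b) < w \<psi>"
  shows "v a < w (\<phi> * \<psi>)"
proof -
  have "v a = v b + v (a / b)"
    using assms(1) valuation_mult[OF v, of b "a / b"] by simp
  then show ?thesis
    using assms unfolding valuation_mult[OF w]
    by (cases rule: valuation_cases[OF v, of b]; cases rule: valuation_cases[OF v, of "a / b"];
        cases rule: valuation_cases[OF w, of \<phi>]; cases rule: valuation_cases[OF w, of \<psi>])
      (auto intro: add_le_less_mono)
qed

lemma less_w_add:
  assumes "v a < w \<phi>" "v a < w \<psi>"
  shows "v a < w (\<phi> + \<psi>)"
  using assms valuation_add[OF w, of \<phi> \<psi>] by (meson less_le_trans min_less_iff_conj)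

text \<open>Horner induction: the difference for \<open>pCons c p\<close> is
  \<open>X * (p(X) - p(z)) + p(z) * (X - z)\<close>. The bound \<open>a\<close> is kept arbitrary
  because the hypothesis is used with other bounds.\<close>

lemma eventually_poly_close:
  assumes "a \<noteq> 0"
  shows "\<forall>\<^sub>F \<nu> in at_top. v a < w (to_fract p - const_fract (poly p (z \<nu>)))"
  using assms
proof (induction p arbitrary: a)
  case 0
  then show ?case
    by (cases rule: valuation_cases[OF v, of a])
      (auto simp: const_fract_def valuation_eq_Pinf_iff[OF w, THEN iffD2])
next
  case (pCons c p)
  obtain b where b: "b \<noteq> 0" "v b \<le> w X_fract"
    using bounded_X by (auto simp: bounded_def)
  obtain d where d: "d \<noteq> 0" "v d \<le> w (to_fract p)"
    using bounded_poly by (auto simp: bounded_def)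
  have "\<forall>\<^sub>F \<nu> in at_top. v (a / b) < w (to_fract p - const_fract (poly p (z \<nu>)))"
    using pCons.IH[of "a / b"] pCons.prems b by simp
  \<comment> \<open>This instance makes \<open>v d\<close> a lower bound for the values of
    \<open>p(z)\<close> too, independent of \<open>\<nu>\<close>.\<close>
  moreover have "\<forall>\<^sub>F \<nu> in at_top. v d < w (to_fract p - const_fract (poly p (z \<nu>)))"
    using pCons.IH[OF d(1)] .
  moreover have "\<forall>\<^sub>F \<nu> in at_top. v (a / d) < w (X_fract - const_fract (z \<nu>))"
    using eventually_X_close[of "a / d"] pCons.prems d by simp
  ultimately show ?case
  proof eventually_elim
    case (elim \<nu>)
    let ?D = "to_fract p - const_fract (poly p (z \<nu>))"
    have "v d \<le> w (to_fract p - ?D)"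
      using valuation_diff[OF w, of "to_fract p" ?D] d(2) elim(2)
      by (meson less_imp_le min.boundedI order_trans)
    then have "v a < w (const_fract (poly p (z \<nu>)) * (X_fract - const_fract (z \<nu>)))"
      using elim(3) d(1) by (intro less_w_mult[of d]) auto
    moreover have "v a < w (X_fract * ?D)"
      using b elim(1) by (intro less_w_mult[of b])
    ultimately have "v a < w (X_fract * ?D
        + const_fract (poly p (z \<nu>)) * (X_fract - const_fract (z \<nu>)))"
      by (intro less_w_add)
    also have "X_fract * ?D + const_fract (poly p (z \<nu>)) * (X_fract - const_fract (z \<nu>))
        = X_fract * to_fract p - const_fract (z \<nu> * poly p (z \<nu>))"
      by (simp add: const_fract_def algebra_simps flip: to_fract_mult)
    also have "\<dots> = to_fract (pCons c p) - const_fract (poly (pCons c p) (z \<nu>))"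
      unfolding to_fract_pCons by (simp add: const_fract_def add_diff_eq flip: to_fract_add to_fract_diff to_fract_uminus)
    finally show ?case .
  qed
qed

lemma eventually_value_eq:
  assumes "a \<noteq> 0" "w (to_fract p) \<le> v a"
  shows "\<forall>\<^sub>F \<nu> in at_top. v (poly p (z \<nu>)) = w (to_fract p)"
  using eventually_poly_close[OF assms(1), of p]
proof eventually_elim
  case (elim \<nu>)
  then show ?case
    using valuation_eq_of_close[OF w, of "to_fract p" "const_fract (poly p (z \<nu>))"] assms(2)
    by (simp add: w_const)
qed

lemma eventually_value_greater:
  assumes "a \<noteq> 0" "v a < w (to_fract p)"
  shows "\<forall>\<^sub>F \<nu> in at_top. v a < v (poly p (z \<nu>))"
  using eventually_poly_close[OF assms(1), of p]
proof eventually_elim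
  case (elim \<nu>)
  then have "v a < min (w (to_fract p)) (w (to_fract p - const_fract (poly p (z \<nu>))))"
    using assms(2) by simp
  also have "\<dots> \<le> v (poly p (z \<nu>))"
    using valuation_diff[OF w, of "to_fract p" "to_fract p - const_fract (poly p (z \<nu>))"]
    by (simp add: w_const)
  finally show ?case .
qed

text \<open>If both values exceeded \<open>vK\<close>, so would those of \<open>r * p\<close> and
  \<open>s * q\<close>, since polynomials are bounded below by \<open>vK\<close>; but the sum is 1,
  of value \<open>v 1\<close>.\<close>

lemma coprime_value_le:
  assumes "r * p + s * q = 1"
  shows "\<exists>a. a \<noteq> 0 \<and> (w (to_fract p) \<le> v a \<or> w (to_fract q) \<le> v a)"
proof (rule ccontr)
  assume "\<not> ?thesis"
  then have *: "v a < w (to_fract p) \<and> v a < w (to_fract q)" if "a \<noteq> 0" for a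
    using that by (meson not_le)
  have large: "v 1 < w (to_fract f * to_fract g)"
    if g: "\<And>a. a \<noteq> 0 \<Longrightarrow> v a < w (to_fract g)" for f g :: "'k poly"
  proof -
    obtain b where b: "b \<noteq> 0" "v b \<le> w (to_fract f)"
      using bounded_poly by (auto simp: bounded_def)
    then show ?thesis
      using g[of "1 / b"] by (intro less_w_mult[of b]) auto
  qed
  have "v 1 < w (to_fract r * to_fract p + to_fract s * to_fract q)"
    using * by (intro less_w_add large) blast+
  then have "v 1 < w (to_fract 1)"
    by (simp add: assms[symmetric])
  then show False
    using valuation_one[OF v] valuation_one[OF w] by simp
qed

lemma eventually_value_le_iff:
  assumes "r * p + s * q = 1"
  shows "(\<forall>\<^sub>F \<nu> in at_top. v (poly q (z \<nu>)) \<le> v (poly p (z \<nu>)))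
    \<longleftrightarrow> w (to_fract q) \<le> w (to_fract p)"
proof -
  \<comment> \<open>With both values above \<open>vK\<close>, closeness would not decide their order
    along the sequence; coprimality excludes this case.\<close>
  obtain a where a: "a \<noteq> 0" "w (to_fract p) \<le> v a \<or> w (to_fract q) \<le> v a"
    using coprime_value_le[OF assms] by blast
  have "\<forall>\<^sub>F \<nu> in at_top. v (poly q (z \<nu>)) \<le> v (poly p (z \<nu>))
    \<longleftrightarrow> w (to_fract q) \<le> w (to_fract p)"
  proof (cases "w (to_fract p) \<le> v a")
    case p: True
    show ?thesis
    proof (cases "w (to_fract q) \<le> v a")
      case True
      show ?thesis
        using eventually_value_eq[OF a(1) p] eventually_value_eq[OF a(1) True]
        by eventually_elim simp
    next
      case False
      then have "v a < w (to_fract q)"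
        by simp
      \<comment> \<open>Both inequalities fail here, since \<open>v a\<close> separates the values
        in \<open>w\<close> and along the sequence.\<close>
      from eventually_value_eq[OF a(1) p] eventually_value_greater[OF a(1) this]
      show ?thesis
        by eventually_elim (use p False in auto)
    qed
  next
    case p: False
    then have q: "w (to_fract q) \<le> v a"
      using a by simp
    from p have "v a < w (to_fract p)"
      by simp
    from eventually_value_eq[OF a(1) q] eventually_value_greater[OF a(1) this]
    show ?thesis
      by eventually_elim (use p q in auto)
  qed
  \<comment> \<open>The right side does not depend on \<open>\<nu>\<close>, and
    \<open>at_top\<close> is a proper filter, so the quantifier drops out there.\<close>
  then have "(\<forall>\<^sub>F \<nu> in at_top. v (poly q (z \<nu>)) \<le> v (poly p (z \<nu>)))
    \<longleftrightarrow> (\<forall>\<^sub>F \<nu> in at_top :: 'i filter. w (to_fract q) \<le> w (to_fract p))"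
    by (rule eventually_subst)
  then show ?thesis
    by simp
qed

end

theorem corollary7p3:
  fixes v :: "'k::field \<Rightarrow> 'g::linordered_ab_group_add extended"
    and w :: "'k poly fract \<Rightarrow> 'g extended"
    and z :: "'i::{wellorder,no_top} \<Rightarrow> 'k"
  assumes "is_valuation v"
    and "is_valuation w" and "extends_valuation w v"
    and "value_transcendental v w"
    and "cauchy_pcs v z" and "algebraic_type v z"
    and "pcs_limit v w z X_fract"
  shows "valuation_ring w = vE_ring v z"
proof (rule Set.set_eqI)
  interpret cauchy_limit v w z
    using assms by unfold_locales
  fix \<phi> :: "'k poly fract"
  obtain p q r s where pq: "\<phi> = Fract p q" "q \<noteq> 0" "r * p + s * q = 1"
    by (rule coprime_Fract_representation)
  \<comment> \<open>In a coprime representation, membership in either ring becomes the same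
    comparison of denominator and numerator under \<open>w\<close>.\<close>
  have "\<phi> \<in> vE_ring v z \<longleftrightarrow> w (to_fract q) \<le> w (to_fract p)"
    using pq by (simp add: vE_ring_def fract_value_nonneg_iff[OF v] eventually_value_le_iff)
  then show "\<phi> \<in> valuation_ring w \<longleftrightarrow> \<phi> \<in> vE_ring v z"
    using pq by (simp add: valuation_ring_def Fract_conv_to_fract valuation_divide_nonneg_iff[OF w])
qed

end
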